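(* Let $F$ be an algebraically closed field, let $n\geq 3$ be an integer, assume $\mathrm{char}(F)=0$ or $\mathrm{char}(F)>n$, and let $S=F[y_1,\ldots,y_n]$. Let $V\subseteq (S_1)^n$ be a one-dimensional $F$-subspace. If $V$ has the $\vec{y}$-local membership property, then $\vec{y}\in V$.
   Context: $S=F[y_1,\ldots,y_n]$ is the polynomial ring in $n$ commuting variables, and $S_1=\mathrm{Span}_F(y_1,\ldots,y_n)\subseteq S$ is the space of homogeneous linear forms (including $0$). $\vec{y}=[y_1,\ldots,y_n]^T\in (S_1)^n\subseteq S^n$. For an $F$-subspace $V\subseteq (S_1)^n$, $S.V$ denotes the $S$-submodule of $S^n$ generated by $V$. For a maximal ideal $\mathfrak{m}\subseteq S$, $\phi_{\mathfrak{m}}:S^n\to (S/\mathfrak{m})^n$ is the map reducing each component modulo $\mathfrak{m}$. An $F$-subspace $V\subseteq (S_1)^n$ has the $\vec{y}$-local membership property if for every maximal ideal $\mathfrak{m}\subseteq S$ one has $\phi_{\mathfrak{m}}(\vec{y})\in \phi_{\mathfrak{m}}(S.V)$. *)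

theory Defs
  imports
    "HOL-Analysis.Finite_Cartesian_Product"
    "HOL-Algebra.QuotRing"
    "HOL-Decision_Procs.Algebra_Aux"
    "HOL-Library.Poly_Mapping"
    "HOL-Computational_Algebra.Polynomial"
begin

text \<open>
  The polynomial ring \<open>S = F[y\<^sub>1, \<dots>, y\<^sub>n]\<close> is the monoid algebra of finitely supported functions
  from exponent vectors to \<open>F\<close>, with convolution as multiplication. The variables are indexed by a
  finite type \<open>'n\<close>, so that \<open>n = CARD('n)\<close>, and \<open>S\<^sup>n\<close> is the type \<open>('a, 'n) pvec\<close>.
\<close>

type_synonym ('a, 'n) mpol = "('n \<Rightarrow>\<^sub>0 nat) \<Rightarrow>\<^sub>0 'a"

type_synonym ('a, 'n) pvec = "('a, 'n) mpol ^ 'n"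

definition const_pol :: "'a::zero \<Rightarrow> ('a, 'n) mpol"
  where "const_pol c = Poly_Mapping.single 0 c"

definition yvar :: "'n \<Rightarrow> ('a::zero_neq_one, 'n) mpol"
  where "yvar i = Poly_Mapping.single (Poly_Mapping.single i 1) 1"

definition yvec :: "('a::zero_neq_one, 'n::finite) pvec"
  where "yvec = (\<chi> i. yvar i)"

lemma const_pol_add: "const_pol (a + b) = const_pol a + const_pol b"
  by (simp add: const_pol_def single_add)

lemma const_pol_mult: "const_pol (a * b) = const_pol a * const_pol b"
  for a b :: "'a::semiring_0"
  by (simp add: const_pol_def mult_single)

lemma const_pol_one: "const_pol 1 = 1"
  by (simp add: const_pol_def)

global_interpretation F_pol: vector_space
  "\<lambda>(c::'a::field) (p::('a, 'n) mpol). const_pol c * p"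
  by unfold_locales
    (simp_all add: const_pol_add const_pol_mult const_pol_one distrib_left distrib_right mult.assoc)

global_interpretation F_vec: vector_space
  "\<lambda>(c::'a::field) (v::('a, 'n::finite) pvec). const_pol c *s v"
proof
  fix a b :: 'a and v w :: "('a, 'n) pvec"
  show "const_pol a *s (v + w) = const_pol a *s v + const_pol a *s w"
    by (vector distrib_left)
  show "const_pol (a + b) *s v = const_pol a *s v + const_pol b *s v"
    by (vector const_pol_add distrib_right)
  show "const_pol a *s (const_pol b *s v) = const_pol (a * b) *s v"
    by (vector const_pol_mult mult.assoc)
  show "const_pol 1 *s v = v"
    by (vector const_pol_one)
qed

global_interpretation S_vec: module
  "\<lambda>(s::('a::field, 'n::finite) mpol) (v::('a, 'n) pvec). s *s v"
proof
  fix s t :: "('a, 'n) mpol" and v w :: "('a, 'n) pvec"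
  show "s *s (v + w) = s *s v + s *s w"
    by (vector distrib_left)
  show "(s + t) *s v = s *s v + t *s v"
    by (vector distrib_right)
  show "s *s (t *s v) = (s * t) *s v"
    by (vector mult.assoc)
  show "1 *s v = v"
    by vector
qed

definition linear_forms :: "('a::field, 'n) mpol set"
  where "linear_forms = F_pol.span (yvar ` UNIV)"

definition linear_form_vectors :: "('a::field, 'n::finite) pvec set"
  where "linear_form_vectors = {v. \<forall>i. v $ i \<in> linear_forms}"

text \<open>Elements of \<open>S/m\<close> are cosets, i.e. elements of the carrier of \<open>cring_class_ops Quot m\<close>.\<close>

definition reduce_mod :: "('a::field, 'n::finite) mpol set \<Rightarrow> ('a, 'n) pvec \<Rightarrow> ('a, 'n) mpol set ^ 'n"
  where "reduce_mod m v = (\<chi> i. m +>\<^bsub>cring_class_ops\<^esub> (v $ i))"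

definition y_local_membership :: "('a::field, 'n::finite) pvec set \<Rightarrow> bool"
  where "y_local_membership V \<longleftrightarrow>
    (\<forall>m. maximalideal m cring_class_ops \<longrightarrow> reduce_mod m yvec \<in> reduce_mod m ` S_vec.span V)"

end

theory Submission
  imports Defs
begin

text \<open>
  A line \<open>V\<close> is spanned by one vector \<open>v\<close> of linear forms, \<open>v\<^sub>i = \<Sum>\<^sub>j A\<^sub>i\<^sub>j y\<^sub>j\<close>, so it is a square matrix
  \<open>A\<close> over \<open>F\<close>, and \<open>S.V\<close> consists of the multiples \<open>s v\<close> with \<open>s \<in> S\<close>. For a point \<open>a \<in> F\<^sup>n\<close> the
  polynomials vanishing at \<open>a\<close> form a maximal ideal, and reduction modulo this ideal is evaluation
  at \<open>a\<close>. There the local membership property says that \<open>a\<close> is a scalar multiple of \<open>A a\<close>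
  (\<open>local_membership_at_point\<close>): every nonzero vector is an eigenvector of \<open>A\<close> with nonzero
  eigenvalue. Hence \<open>A\<close> is scalar and nonzero, and its multiple \<open>yvec\<close> lies in \<open>V\<close>.

  The points needed to see that \<open>A\<close> is scalar are the unit vectors, which make \<open>A\<close> diagonal with
  nonzero entries, and the all-ones vector, which makes these entries equal.
\<close>

section \<open>Evaluation of polynomials at a point\<close>

definition monom_value :: "('n::finite \<Rightarrow> 'a::comm_semiring_1) \<Rightarrow> ('n \<Rightarrow>\<^sub>0 nat) \<Rightarrow> 'a"
  where "monom_value a k = (\<Prod>i\<in>UNIV. a i ^ Poly_Mapping.lookup k i)"

definition pol_value :: "('n::finite \<Rightarrow> 'a::comm_semiring_1) \<Rightarrow> ('a, 'n) mpol \<Rightarrow> 'a"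
  where "pol_value a p =
    (\<Sum>k\<in>Poly_Mapping.keys p. Poly_Mapping.lookup p k * monom_value a k)"

lemma monom_value_0: "monom_value a 0 = 1"
  by (simp add: monom_value_def)

lemma monom_value_add: "monom_value a (k + l) = monom_value a k * monom_value a l"
  by (simp add: monom_value_def lookup_add power_add prod.distrib)

lemma monom_value_single: "monom_value a (Poly_Mapping.single i 1) = a i"
proof -
  have "monom_value a (Poly_Mapping.single i 1) = (\<Prod>j\<in>UNIV. if j = i then a i else 1)"
    unfolding monom_value_def by (rule prod.cong) (auto simp: lookup_single when_def)
  then show ?thesis by simp
qed

lemma pol_value_superset:
  assumes "finite K" "Poly_Mapping.keys p \<subseteq> K"
  shows "pol_value a p = (\<Sum>k\<in>K. Poly_Mapping.lookup p k * monom_value a k)"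
  unfolding pol_value_def using assms
  by (intro sum.mono_neutral_left) (auto simp: in_keys_iff)

lemma pol_value_0 [simp]: "pol_value a 0 = 0"
  by (simp add: pol_value_def)

lemma pol_value_add: "pol_value a (p + q) = pol_value a p + pol_value a q"
proof -
  let ?K = "Poly_Mapping.keys p \<union> Poly_Mapping.keys q"
  have "pol_value a (p + q) = (\<Sum>k\<in>?K. Poly_Mapping.lookup (p + q) k * monom_value a k)"
    by (rule pol_value_superset) (simp_all add: keys_add)
  also have "\<dots> = (\<Sum>k\<in>?K. Poly_Mapping.lookup p k * monom_value a k)
      + (\<Sum>k\<in>?K. Poly_Mapping.lookup q k * monom_value a k)"
    by (simp add: lookup_add distrib_right sum.distrib)
  also have "\<dots> = pol_value a p + pol_value a q"
    by (simp add: pol_value_superset [of ?K])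
  finally show ?thesis .
qed

lemma pol_value_sum: "pol_value a (\<Sum>i\<in>I. p i) = (\<Sum>i\<in>I. pol_value a (p i))"
  by (induction I rule: infinite_finite_induct) (simp_all add: pol_value_add)

lemma pol_value_single: "pol_value a (Poly_Mapping.single k c) = c * monom_value a k"
  by (simp add: pol_value_def)

lemma pol_value_const: "pol_value a (const_pol c) = c"
  by (simp add: const_pol_def pol_value_single monom_value_0)

lemma pol_value_yvar: "pol_value a (yvar i) = a i"
  unfolding yvar_def pol_value_single monom_value_single by simp

lemma mpol_induct [case_names zero single_add]:
  fixes p :: "'k \<Rightarrow>\<^sub>0 'b::comm_monoid_add"
  assumes "P 0" and "\<And>k c p. P p \<Longrightarrow> P (Poly_Mapping.single k c + p)"
  shows "P p"
proof (induction p rule: update_induct)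
  case const
  show ?case by (rule assms(1))
next
  case (update p k c)
  have "Poly_Mapping.update k c p = Poly_Mapping.single k c + p"
    using update(1)
    by (intro poly_mapping_eqI)
       (auto simp: lookup_update lookup_add lookup_single when_def in_keys_iff)
  then show ?case using assms(2) update by simp
qed

lemma pol_value_mult: "pol_value a (p * q) = pol_value a p * pol_value a q"
proof (induction p rule: mpol_induct)
  case zero
  show ?case by simp
next
  case (single_add k c p)
  have "pol_value a (Poly_Mapping.single k c * q) = c * monom_value a k * pol_value a q"
    by (induction q rule: mpol_induct)
       (simp_all add: distrib_left pol_value_add mult_single pol_value_single monom_value_add ac_simps)
  then show ?case
    using single_add by (simp add: distrib_right pol_value_add pol_value_single)
qed

section \<open>Points are maximal ideals\<close>

text \<open>
  If \<open>h x \<noteq> 0\<close> then \<open>h y = inverse (h x)\<close> for some \<open>y\<close>, so \<open>1 - x * y\<close> is in the kernel: an ideal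
  that contains the kernel and \<open>x\<close> contains \<open>1\<close>.
\<close>
lemma maximalideal_kernel:
  fixes h :: "'r::comm_ring_1 \<Rightarrow> 'k::field"
  assumes add: "\<And>x y. h (x + y) = h x + h y"
    and mult: "\<And>x y. h (x * y) = h x * h y"
    and surj: "surj h"
  shows "maximalideal {x. h x = 0} cring_class_ops"
proof (rule maximalidealI)
  have h0: "h 0 = 0" using add [of 0 0] by (metis add.right_neutral add_left_cancel)
  have h_uminus: "h (- x) = - h x" for x
    using add [of x "- x"] h0 by (simp add: add_eq_0_iff)
  obtain e where "h e = 1" using surj by (metis surj_def)
  then have h1: "h 1 = 1" using mult [of e 1] by simp
  show "ideal {x. h x = 0} cring_class_ops"
  proof (rule idealI)
    show "ring (cring_class_ops :: 'r ring)"
      by (rule cring_class.ring_axioms)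
    show "subgroup {x. h x = 0} (add_monoid cring_class_ops)"
    proof (rule group.subgroupI)
      show "group (add_monoid (cring_class_ops :: 'r ring))"
        by (rule abelian_group.a_group) (rule ring.is_abelian_group, rule cring_class.ring_axioms)
      fix x assume "x \<in> {x. h x = 0}"
      then show "inv\<^bsub>add_monoid cring_class_ops\<^esub> x \<in> {x. h x = 0}"
        using uminus_class [of x] by (simp add: a_inv_def h_uminus)
    qed (use h0 in \<open>auto simp: cring_class_ops_def add\<close>)
  qed (auto simp: times_class mult)
  show "carrier cring_class_ops \<noteq> {x. h x = 0}"
    using h1 by (metis carrier_class mem_Collect_eq zero_neq_one)
  fix J :: "'r set"
  assume J: "ideal J cring_class_ops" and ker: "{x. h x = 0} \<subseteq> J"
  interpret J: ideal J cring_class_ops by (rule J)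
  show "J = {x. h x = 0} \<or> J = carrier cring_class_ops"
  proof (rule disj_imp [THEN iffD2], rule impI)
    assume "J \<noteq> {x. h x = 0}"
    then obtain x where x: "x \<in> J" "h x \<noteq> 0" using ker by auto
    obtain y where y: "h y = inverse (h x)" using surj by (metis surj_def)
    have "h (1 + - (x * y)) = 0" using x(2) y by (simp only: add mult h_uminus h1) simp
    then have "1 + - (x * y) \<in> J" using ker by blast
    moreover have "x * y \<in> J"
      using J.I_r_closed [OF x(1) carrier_class, of y] by (simp add: times_class)
    ultimately have "(1 + - (x * y)) + x * y \<in> J"
      using J.a_closed by (metis plus_class)
    then have "\<one>\<^bsub>cring_class_ops\<^esub> \<in> J" by (simp add: one_class)
    then show "J = carrier cring_class_ops" by (rule J.one_imp_carrier)
  qed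
qed

lemma maximalideal_point:
  fixes a :: "'n::finite \<Rightarrow> 'a::field"
  shows "maximalideal {p. pol_value a p = 0} cring_class_ops"
proof (rule maximalideal_kernel)
  show "surj (pol_value a)"
    by (rule surjI [of _ const_pol]) (rule pol_value_const)
qed (rule pol_value_add pol_value_mult)+

lemma reduce_mod_point_eq:
  fixes v w :: "('a::field, 'n::finite) pvec"
  assumes "reduce_mod {p. pol_value a p = 0} v = reduce_mod {p. pol_value a p = 0} w"
  shows "pol_value a (v $ i) = pol_value a (w $ i)"
proof -
  let ?m = "{p. pol_value a p = 0}"
  have "?m +>\<^bsub>cring_class_ops\<^esub> (v $ i) = ?m +>\<^bsub>cring_class_ops\<^esub> (w $ i)"
    using assms by (simp add: reduce_mod_def vec_eq_iff)
  moreover have "v $ i \<in> ?m +>\<^bsub>cring_class_ops\<^esub> (v $ i)"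
    by (auto simp: a_r_coset_def' plus_class intro!: exI [of _ 0])
  ultimately show ?thesis
    by (auto simp: a_r_coset_def' plus_class pol_value_add)
qed

section \<open>Lines of linear forms\<close>

lemma linear_form_coeffs:
  assumes "p \<in> (linear_forms :: ('a::field, 'n::finite) mpol set)"
  obtains c where "p = (\<Sum>j\<in>UNIV. const_pol (c j) * yvar j)"
proof -
  have "F_pol.subspace {p :: ('a, 'n) mpol. \<exists>c. p = (\<Sum>j\<in>UNIV. const_pol (c j) * yvar j)}"
  proof (rule F_pol.subspaceI, goal_cases)
    case 1
    show ?case unfolding mem_Collect_eq
      by (rule exI [of _ "\<lambda>_. 0"]) (simp add: const_pol_def)
  next
    case (2 p q)
    then obtain c d where "p = (\<Sum>j\<in>UNIV. const_pol (c j) * yvar j)"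
      "q = (\<Sum>j\<in>UNIV. const_pol (d j) * yvar j)" by blast
    then show ?case unfolding mem_Collect_eq
      by (intro exI [of _ "\<lambda>j. c j + d j"])
         (simp add: const_pol_add distrib_right sum.distrib)
  next
    case (3 b p)
    then obtain c where "p = (\<Sum>j\<in>UNIV. const_pol (c j) * yvar j)" by blast
    then have "const_pol b * p = (\<Sum>j\<in>UNIV. const_pol (b * c j) * yvar j)"
      by (simp only: const_pol_mult sum_distrib_left mult.assoc)
    then show ?case unfolding mem_Collect_eq by (intro exI [of _ "\<lambda>j. b * c j"])
  qed
  moreover have "\<exists>c. (yvar i :: ('a, 'n) mpol) = (\<Sum>j\<in>UNIV. const_pol (c j) * yvar j)" for i
  proof
    have "(\<Sum>j\<in>UNIV. const_pol (if j = i then 1 else 0) * (yvar j :: ('a, 'n) mpol))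
        = (\<Sum>j\<in>UNIV. if j = i then yvar i else 0)"
      by (rule sum.cong) (auto simp: const_pol_one const_pol_def)
    then show "(yvar i :: ('a, 'n) mpol)
        = (\<Sum>j\<in>UNIV. const_pol ((\<lambda>j. if j = i then 1 else 0) j) * yvar j)"
      by simp
  qed
  ultimately have "linear_forms \<subseteq>
      {p :: ('a, 'n) mpol. \<exists>c. p = (\<Sum>j\<in>UNIV. const_pol (c j) * yvar j)}"
    unfolding linear_forms_def by (intro F_pol.span_minimal) blast+
  then show thesis using assms that by blast
qed

lemma dim_1_span_singleton:
  fixes V :: "('a::field, 'n::finite) pvec set"
  assumes "F_vec.subspace V" "F_vec.dim V = 1"
  obtains v where "v \<in> V" "V = F_vec.span {v}"
proof -
  obtain B where B: "B \<subseteq> V" "V \<subseteq> F_vec.span B" "card B = F_vec.dim V"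
    by (rule F_vec.basis_exists [of V]) (rule that)
  obtain v where v: "B = {v}"
    using card_1_singletonE [OF B(3) [unfolded assms(2)]] .
  have "F_vec.span {v} \<subseteq> V"
    using F_vec.span_minimal [OF B(1) assms(1)] unfolding v .
  with B(2) have "V = F_vec.span {v}" unfolding v by (rule subset_antisym)
  moreover have "v \<in> V" using B(1) unfolding v by (rule subsetD) (rule singletonI)
  ultimately show thesis using that by blast
qed

text \<open>The multiplier \<open>c\<close> is the value at \<open>a\<close> of the polynomial \<open>s\<close> with \<open>yvec\<close> congruent to \<open>s v\<close>.\<close>
lemma local_membership_at_point:
  fixes v :: "('a::field, 'n::finite) pvec"
  assumes "y_local_membership (F_vec.span {v})"
  obtains c where "\<And>i. a i = c * pol_value a (v $ i)"
proof -
  let ?m = "{p. pol_value a p = 0}"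
  have "S_vec.span (F_vec.span {v}) \<subseteq> range (\<lambda>s. s *s v)"
  proof (rule S_vec.span_minimal)
    show "F_vec.span {v} \<subseteq> range (\<lambda>s. s *s v)"
      by (auto simp: F_vec.span_singleton)
    show "S_vec.subspace (range (\<lambda>s. s *s v))"
      using S_vec.subspace_span [of "{v}"] by (simp add: S_vec.span_singleton)
  qed
  moreover obtain w where "w \<in> S_vec.span (F_vec.span {v})"
    and w: "reduce_mod ?m yvec = reduce_mod ?m w"
    using assms [unfolded y_local_membership_def, rule_format, OF maximalideal_point [of a]]
    by (rule imageE)
  ultimately obtain s where s: "w = s *s v" by blast
  have "a i = pol_value a s * pol_value a (v $ i)" for i
  proof -
    have "a i = pol_value a (yvec $ i)" by (simp add: yvec_def pol_value_yvar)
    also have "\<dots> = pol_value a (w $ i)" using w by (rule reduce_mod_point_eq)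
    also have "\<dots> = pol_value a s * pol_value a (v $ i)" by (simp add: s pol_value_mult)
    finally show ?thesis .
  qed
  then show thesis by (rule that)
qed

lemma matrix_eigenvectors_imp_scalar:
  fixes A :: "'n::finite \<Rightarrow> 'n \<Rightarrow> 'a::field"
  assumes eig: "\<And>a. \<exists>c. \<forall>i. a i = c * (\<Sum>j\<in>UNIV. A i j * a j)"
  obtains l where "l \<noteq> 0" "\<And>i j. A i j = (if i = j then l else 0)"
proof -
  have unit: "A j j \<noteq> 0 \<and> (\<forall>i. i \<noteq> j \<longrightarrow> A i j = 0)" for j
  proof -
    obtain c where "\<forall>i. (if i = j then 1 else 0)
        = c * (\<Sum>k\<in>UNIV. A i k * (if k = j then 1 else 0))"
      using eig [of "\<lambda>i. if i = j then 1 else 0"] by blast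
    moreover have "(\<Sum>k\<in>UNIV. A i k * (if k = j then 1 else 0)) = A i j" for i
      by (simp add: if_distrib cong: if_cong)
    ultimately have c: "(if i = j then 1 else 0) = c * A i j" for i by metis
    from c [of j] have "c \<noteq> 0" "A j j \<noteq> 0" by auto
    with c show ?thesis by (metis mult_eq_0_iff)
  qed
  obtain c where "\<forall>i. 1 = c * (\<Sum>j\<in>UNIV. A i j * 1)"
    using eig [of "\<lambda>_. 1"] by blast
  moreover have "(\<Sum>j\<in>UNIV. A i j * 1) = A i i" for i
  proof -
    have "(\<Sum>j\<in>UNIV. A i j * 1) = (\<Sum>j\<in>UNIV. if j = i then A i i else 0)"
      using unit by (intro sum.cong) auto
    then show ?thesis by simp
  qed
  ultimately have c: "c * A i i = 1" for i by metis
  then have "c \<noteq> 0" by auto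
  then have diag: "A i i = inverse c" for i
    using c [of i] by (simp add: field_simps)
  show thesis
    by (rule that [of "inverse c"]) (use diag unit \<open>c \<noteq> 0\<close> in auto)
qed

theorem mainTheorem3:
  fixes V :: "('a::alg_closed_field, 'n::finite) pvec set"
  assumes "CARD('n) \<ge> 3"
    and "CHAR('a) = 0 \<or> CHAR('a) > CARD('n)"
    and "V \<subseteq> linear_form_vectors"
    and "F_vec.subspace V"
    and "F_vec.dim V = 1"
    and "y_local_membership V"
  shows "yvec \<in> V"
proof -
  obtain v where v: "v \<in> V" "V = F_vec.span {v}"
    using dim_1_span_singleton assms(4,5) by blast
  have "\<exists>c. v $ i = (\<Sum>j\<in>UNIV. const_pol (c j) * yvar j)" for i
    using v(1) assms(3) linear_form_coeffs [of "v $ i"] unfolding linear_form_vectors_def by blast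
  then obtain A where A: "\<And>i. v $ i = (\<Sum>j\<in>UNIV. const_pol (A i j) * yvar j)"
    by metis
  have membership: "y_local_membership (F_vec.span {v})"
    using assms(6) unfolding v(2) .
  have "\<exists>c. \<forall>i. a i = c * (\<Sum>j\<in>UNIV. A i j * a j)" for a
  proof -
    obtain c where "\<And>i. a i = c * pol_value a (v $ i)"
      by (rule local_membership_at_point [OF membership, of a]) (rule that)
    moreover have "pol_value a (v $ i) = (\<Sum>j\<in>UNIV. A i j * a j)" for i
      by (simp add: A pol_value_sum pol_value_mult pol_value_const pol_value_yvar)
    ultimately show ?thesis by metis
  qed
  then obtain l where l: "l \<noteq> 0" "\<And>i j. A i j = (if i = j then l else 0)"
    using matrix_eigenvectors_imp_scalar [of A] by metis
  have "v $ i = const_pol l * yvar i" for i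
  proof -
    have "v $ i = (\<Sum>j\<in>UNIV. if j = i then const_pol l * yvar i else 0)"
      unfolding A by (rule sum.cong) (auto simp: l const_pol_def)
    then show ?thesis by simp
  qed
  then have "const_pol (inverse l) *s v = yvec"
    using l(1) by (simp add: vec_eq_iff yvec_def mult.assoc [symmetric]
        const_pol_mult [symmetric] const_pol_one)
  then show ?thesis
    using F_vec.subspace_scale [OF assms(4) v(1)] by metis
qed

end
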